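(* Every 1-truth-table degree except that of the recursive sets contains a set that is compressible by a total recursive function but is not rankable by a total recursive function.
   Context: All sets are subsets of $\Sigma^\ast$ with $\Sigma=\{0,1\}$, with strings ordered lexicographically in the standard computer-science sense ($\epsilon < 0 < 1 < 00 < \cdots$). A (possibly partial) function $f$ is a compression function for a set $A$ if $f$ is defined on every element of $A$, $f(A)=\Sigma^\ast$, and $f$ is injective on $A$ (its behavior on strings outside $A$ is unconstrained). A (possibly partial) function $f$ is a ranking function for $A$ if $f$ is defined on every element of $A$ and, for each $x\in A$, $f(x)$ is the $i$th string of $\Sigma^\ast$ where $x$ is the $i$th string of $A$ (i.e., $f(x)=\|A^{\le x}\|$, the number of elements of $A$ lexicographically at most $x$); again behavior outside $A$ is unconstrained. A set is compressible (resp. rankable) by a total recursive function if some total recursive function from $\Sigma^\ast$ to $\Sigma^\ast$ is a compression (resp. ranking) function for it. $A$ 1-truth-table reduces to $B$ if $A$ is Turing reducible to $B$ via a recursive transducer making at most one query to $B$ on each input; 1-truth-table degrees are the equivalence classes of mutual 1-truth-table reducibility, and the recursive sets form one such degree. *)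

theory Defs
  imports "HOL-Library.List_Lenlexorder"
begin

section \<open>Strings\<close>

text \<open>
  With False and True playing the roles of 0 and 1, the order imported for lists is
  length first, ties broken lexicographically: \<open>[] < [0] < [1] < [0,0] < \<dots>\<close>.
\<close>

type_synonym str = "bool list"

text \<open>
  Bijective base-2 value, i.e. the number of strings strictly below the given one. It is used
  only to transfer recursiveness from \<open>nat\<close> to strings.
\<close>

definition str_code :: "str \<Rightarrow> nat" where
  "str_code w = foldl (\<lambda>n b. 2 * n + (if b then 2 else 1)) 0 w"

lemma str_code_Nil [simp]: "str_code [] = 0"
  by (simp add: str_code_def)

lemma str_code_snoc [simp]: "str_code (w @ [b]) = 2 * str_code w + (if b then 2 else 1)"
  by (simp add: str_code_def)

lemma str_code_bounds: "2 ^ length w \<le> str_code w + 1 \<and> str_code w + 1 < 2 ^ (length w + 1)"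
  by (induction w rule: rev_induct) auto

lemma str_code_less_same_length:
  "length v = length w \<Longrightarrow> (v, w) \<in> lex {(u, v). u < v} \<Longrightarrow> str_code v < str_code w"
proof (induction v arbitrary: w rule: rev_induct)
  case (snoc a v)
  from snoc.prems(1) obtain w' b where w: "w = w' @ [b]"
    by (cases w rule: rev_cases) auto
  with snoc.prems have len: "length v = length w'" by simp
  have "(v, w') \<in> lex {(u, v). u < v} \<or> v = w' \<and> a < b"
  proof -
    obtain xys x y xs' ys' where d: "v @ [a] = xys @ x # xs'" "w' @ [b] = xys @ y # ys'" "x < y"
      using snoc.prems(2) unfolding w lex_conv by auto
    show ?thesis
    proof (cases xs' rule: rev_cases)
      case Nil
      with d len show ?thesis by (cases ys' rule: rev_cases) auto
    next
      case (snoc us c)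
      with d(1) have v: "v = xys @ x # us"
        by (metis append_Cons append_assoc butlast_snoc)
      with d len have "ys' \<noteq> []" by auto
      then obtain vs e where "ys' = vs @ [e]" by (cases ys' rule: rev_cases) auto
      with d(2) have "w' = xys @ y # vs"
        by (metis append_Cons append_assoc butlast_snoc)
      with v d(3) len show ?thesis unfolding lex_conv by auto
    qed
  qed
  then show ?case
  proof
    assume "(v, w') \<in> lex {(u, v). u < v}"
    with snoc.IH len have "str_code v < str_code w'" by blast
    then show ?thesis by (auto simp: w)
  qed (auto simp: w)
qed simp

lemma str_code_strict_mono: "strict_mono str_code"
proof (rule strict_monoI)
  fix v w :: str assume "v < w"
  then consider "length v < length w"
    | "length v = length w" "(v, w) \<in> lex {(u, v). u < v}"
    by (auto simp: list_less_def lenlex_conv)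
  then show "str_code v < str_code w"
  proof cases
    case 1
    then have "(2::nat) ^ (length v + 1) \<le> 2 ^ length w"
      by (intro power_increasing) auto
    with str_code_bounds[of v] str_code_bounds[of w] show ?thesis by linarith
  qed (rule str_code_less_same_length)
qed

lemma str_code_bij: "bij str_code"
proof -
  have "\<exists>w. str_code w = n" for n
  proof (induction n rule: less_induct)
    case (less n)
    show ?case
    proof (cases "n = 0")
      case False
      then obtain w where "str_code w = (n - 1) div 2" using less by fastforce
      then have "str_code (w @ [even n]) = n" using False by (auto elim!: evenE oddE)
      then show ?thesis ..
    qed (auto intro: exI[of _ "[]"])
  qed
  then show ?thesis
    by (metis bijI surjI strict_mono_imp_inj_on str_code_strict_mono surj_def)
qed


section \<open>Recursive functions, relative to a set of strings\<close>

text \<open>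
  Kleene's schemata over \<open>nat\<close>, together with an instruction \<open>Query\<close> that asks whether the
  string coded by the argument belongs to the queried set.
\<close>

datatype prog =
    Zero
  | Succ
  | Proj nat
  | Query
  | Comp prog "prog list"
  | PrimRec prog prog
  | Mu prog

text \<open>
  \<open>eval X p xs y q\<close>: with queries answered according to \<open>X\<close>, the program \<open>p\<close> halts on the
  arguments \<open>xs\<close> with result \<open>y\<close>, having made exactly \<open>q\<close> queries. If the computation diverges
  (or an argument list has an unsuitable length), then no \<open>y\<close> and \<open>q\<close> are related to \<open>p\<close> and \<open>xs\<close>.
  Note that \<open>Comp\<close> evaluates all of its arguments, and that \<open>Mu\<close> pays for the queries of every
  value it tests.
\<close>

inductive
  eval :: "str set \<Rightarrow> prog \<Rightarrow> nat list \<Rightarrow> nat \<Rightarrow> nat \<Rightarrow> bool" and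
  evals :: "str set \<Rightarrow> prog list \<Rightarrow> nat list \<Rightarrow> nat list \<Rightarrow> nat \<Rightarrow> bool"
  for X :: "str set"
where
  eval_Zero: "eval X Zero xs 0 0"
| eval_Succ: "eval X Succ [x] (Suc x) 0"
| eval_Proj: "i < length xs \<Longrightarrow> eval X (Proj i) xs (xs ! i) 0"
| eval_Query: "eval X Query [str_code w] (of_bool (w \<in> X)) 1"
| eval_Comp: "evals X ps xs ys q \<Longrightarrow> eval X p ys z r \<Longrightarrow> eval X (Comp p ps) xs z (q + r)"
| eval_PrimRec_0: "eval X p xs y q \<Longrightarrow> eval X (PrimRec p p') (0 # xs) y q"
| eval_PrimRec_Suc: "eval X (PrimRec p p') (n # xs) y q \<Longrightarrow> eval X p' (n # y # xs) z r \<Longrightarrow>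
    eval X (PrimRec p p') (Suc n # xs) z (q + r)"
| eval_Mu: "(\<And>m. m < n \<Longrightarrow> eval X p (m # xs) (Suc (y m)) (q m)) \<Longrightarrow> eval X p (n # xs) 0 (q n) \<Longrightarrow>
    eval X (Mu p) xs n (\<Sum>m\<le>n. q m)"
| evals_Nil: "evals X [] xs [] 0"
| evals_Cons: "eval X p xs y q \<Longrightarrow> evals X ps xs ys r \<Longrightarrow> evals X (p # ps) xs (y # ys) (q + r)"

lemma eval_evals_deterministic:
  "eval X p xs y q \<Longrightarrow> eval X p xs y' q' \<Longrightarrow> y' = y \<and> q' = q"
  "evals X ps xs ys r \<Longrightarrow> evals X ps xs ys' r' \<Longrightarrow> ys' = ys \<and> r' = r"
proof (induction arbitrary: y' q' and ys' r' rule: eval_evals.inducts)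
  case (eval_Query w)
  then show ?case
    by (cases rule: eval.cases) (auto dest: injD[OF bij_is_inj[OF str_code_bij]])
next
  case (eval_Comp ps xs ys q p z r)
  from eval_Comp.prems show ?case by (cases rule: eval.cases) (use eval_Comp.IH in blast)
next
  case (eval_PrimRec_0 p xs y q p')
  from eval_PrimRec_0.prems show ?case
    by (cases rule: eval.cases) (use eval_PrimRec_0.IH in blast)+
next
  case (eval_PrimRec_Suc p p' n xs y q z r)
  from eval_PrimRec_Suc.prems show ?case
    by (cases rule: eval.cases) (use eval_PrimRec_Suc.IH in blast)+
next
  case (eval_Mu n p xs y q)
  note IH = eval_Mu.IH
  from eval_Mu.prems show ?case
  proof (cases rule: eval.cases)
    case (eval_Mu y2 q2)
    have "\<not> y' < n" using eval_Mu(3) IH(2) by fastforce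
    moreover have "\<not> n < y'" using eval_Mu(2) IH(4) by fastforce
    ultimately have [simp]: "y' = n" by simp
    have "q2 m = q m" if "m \<le> n" for m
      using that eval_Mu(2)[of m] eval_Mu(3) IH(2)[of m] IH(4)
      by (cases "m = n") auto
    then show ?thesis using eval_Mu(1) by simp
  qed
next
  case (evals_Cons p xs y q ps ys r)
  from evals_Cons.prems show ?case by (cases rule: evals.cases) (use evals_Cons.IH in blast)
qed (auto elim: eval.cases evals.cases)

fun query_free :: "prog \<Rightarrow> bool" where
  "query_free Query = False"
| "query_free (Comp p ps) = (query_free p \<and> (\<forall>p'\<in>set ps. query_free p'))"
| "query_free (PrimRec p p') = (query_free p \<and> query_free p')"
| "query_free (Mu p) = query_free p"
| "query_free _ = True"

text \<open>The set \<open>{}\<close> below is irrelevant, since query-free programs never consult it.\<close>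

definition total_recursive :: "(str \<Rightarrow> str) \<Rightarrow> bool" where
  "total_recursive f \<longleftrightarrow>
    (\<exists>p. query_free p \<and> (\<forall>w. eval {} p [str_code w] (str_code (f w)) 0))"

definition recursive_set :: "str set \<Rightarrow> bool" where
  "recursive_set A \<longleftrightarrow>
    (\<exists>p. query_free p \<and> (\<forall>w. eval {} p [str_code w] (of_bool (w \<in> A)) 0))"


section \<open>1-truth-table degrees\<close>

definition turing_reduces_via :: "prog \<Rightarrow> str set \<Rightarrow> str set \<Rightarrow> bool" where
  "turing_reduces_via p A B \<longleftrightarrow> (\<forall>w. \<exists>q. eval B p [str_code w] (of_bool (w \<in> A)) q)"

text \<open>
  As usual for truth-table reductions, the transducer has to halt (and respect the query bound)
  whatever the answers to its queries are, not just for those given by the set reduced to.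
\<close>

definition one_query_transducer :: "prog \<Rightarrow> bool" where
  "one_query_transducer p \<longleftrightarrow> (\<forall>X w. \<exists>y q. eval X p [str_code w] y q \<and> q \<le> 1)"

definition one_tt_reducible :: "str set \<Rightarrow> str set \<Rightarrow> bool" where
  "one_tt_reducible A B \<longleftrightarrow> (\<exists>p. one_query_transducer p \<and> turing_reduces_via p A B)"

definition one_tt_equiv :: "(str set \<times> str set) set" where
  "one_tt_equiv = {(A, B). one_tt_reducible A B \<and> one_tt_reducible B A}"

definition one_tt_degrees :: "str set set set" where
  "one_tt_degrees = UNIV // one_tt_equiv"


text \<open>
  The relation is an equivalence, and the recursive sets form one of its classes. Both follow by
  replacing queries with subprograms.
\<close>

fun subst_query :: "prog \<Rightarrow> prog \<Rightarrow> prog" where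
  "subst_query t Query = t"
| "subst_query t (Comp p ps) = Comp (subst_query t p) (map (subst_query t) ps)"
| "subst_query t (PrimRec p p') = PrimRec (subst_query t p) (subst_query t p')"
| "subst_query t (Mu p) = Mu (subst_query t p)"
| "subst_query t p = p"

lemma eval_subst_query:
  assumes "\<And>w. \<exists>q\<le>k. eval Y t [str_code w] (of_bool (w \<in> X)) q"
  shows "eval X p xs y q \<Longrightarrow> \<exists>q'\<le>k * q. eval Y (subst_query t p) xs y q'"
    and "evals X ps xs ys r \<Longrightarrow> \<exists>r'\<le>k * r. evals Y (map (subst_query t) ps) xs ys r'"
proof (induction rule: eval_evals.inducts)
  case (eval_Mu n p xs y q)
  define P where "P = (\<lambda>m r. r \<le> k * q m \<and>
      eval Y (subst_query t p) (m # xs) (if m < n then Suc (y m) else 0) r)"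
  have "\<exists>r. P m r" if "m \<le> n" for m
    using that eval_Mu.IH(2)[of m] eval_Mu.IH(4) unfolding P_def by (cases "m = n") auto
  then obtain r where r: "P m (r m)" if "m \<le> n" for m by metis
  have "eval Y (Mu (subst_query t p)) xs n (\<Sum>m\<le>n. r m)"
  proof (rule eval_evals.eval_Mu)
    show "eval Y (subst_query t p) (m # xs) (Suc (y m)) (r m)" if "m < n" for m
      using r[of m] that by (simp add: P_def)
    show "eval Y (subst_query t p) (n # xs) 0 (r n)" using r[of n] by (simp add: P_def)
  qed
  moreover have "(\<Sum>m\<le>n. r m) \<le> k * (\<Sum>m\<le>n. q m)"
    unfolding sum_distrib_left by (rule sum_mono) (use r P_def in auto)
  ultimately show ?case by auto
next
  case (eval_Comp ps xs ys q p z r)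
  then obtain a b where "a \<le> k * q" "b \<le> k * r" "evals Y (map (subst_query t) ps) xs ys a"
    "eval Y (subst_query t p) ys z b" by blast
  then show ?case
    by (auto intro!: exI[of _ "a + b"] eval_evals.eval_Comp simp: distrib_left)
next
  case (eval_PrimRec_Suc p p' n xs y q z r)
  then obtain a b where "a \<le> k * q" "b \<le> k * r"
    "eval Y (PrimRec (subst_query t p) (subst_query t p')) (n # xs) y a"
    "eval Y (subst_query t p') (n # y # xs) z b" by auto
  then show ?case
    by (auto intro!: exI[of _ "a + b"] eval_evals.eval_PrimRec_Suc simp: distrib_left)
next
  case (evals_Cons p xs y q ps ys r)
  then obtain a b where "a \<le> k * q" "b \<le> k * r" "eval Y (subst_query t p) xs y a"
    "evals Y (map (subst_query t) ps) xs ys b" by blast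
  then show ?case
    by (auto intro!: exI[of _ "a + b"] eval_evals.evals_Cons simp: distrib_left)
next
  case (eval_Query w)
  show ?case using assms[of w] by simp
next
  case (eval_PrimRec_0 p xs y q p')
  then show ?case using eval_evals.eval_PrimRec_0 by fastforce
qed (simp_all add: eval_Zero eval_Succ eval_Proj evals_Nil)

lemma evals_singleton: "eval X p xs y q \<Longrightarrow> evals X [p] xs [y] q"
  using evals_Cons[OF _ evals_Nil] by fastforce

definition sg :: prog where "sg = PrimRec Zero (Comp Succ [Zero])"

lemma eval_sg: "eval X sg [n] (of_bool (n > 0)) 0"
proof (induction n)
  case 0
  show ?case using eval_PrimRec_0[OF eval_Zero] by (simp add: sg_def)
next
  case (Suc n)
  have "eval X (Comp Succ [Zero]) [n, of_bool (n > 0)] 1 0"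
    using eval_Comp[OF evals_singleton[OF eval_Zero] eval_Succ] by simp
  from eval_PrimRec_Suc[OF Suc[unfolded sg_def] this] show ?case by (simp add: sg_def)
qed

lemma one_tt_refl: "one_tt_reducible A A"
  unfolding one_tt_reducible_def one_query_transducer_def turing_reduces_via_def
  using eval_Query by (intro exI[of _ Query]) (meson order_refl)

lemma one_tt_trans:
  assumes "one_tt_reducible A B" "one_tt_reducible B C"
  shows "one_tt_reducible A C"
proof -
  obtain p where p: "one_query_transducer p" "turing_reduces_via p A B"
    using assms unfolding one_tt_reducible_def by blast
  obtain t where t: "one_query_transducer t" "turing_reduces_via t B C"
    using assms unfolding one_tt_reducible_def by blast
  define s where "s = Comp sg [t]"
  define p' where "p' = subst_query s p"
  define D where "D = (\<lambda>X. {w. \<exists>y q. eval X t [str_code w] y q \<and> 0 < y})"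
  have s: "\<exists>q\<le>1. eval X s [str_code w] (of_bool (w \<in> D X)) q" for X w
  proof -
    obtain y q where "eval X t [str_code w] y q" "q \<le> 1"
      using t(1) unfolding one_query_transducer_def by blast
    moreover from this have "w \<in> D X \<longleftrightarrow> 0 < y"
      using eval_evals_deterministic(1) unfolding D_def by blast
    ultimately show ?thesis using eval_Comp[OF evals_singleton eval_sg, of X t "[str_code w]" y q]
      by (auto simp: s_def)
  qed
  have "w \<in> D C \<longleftrightarrow> w \<in> B" for w
  proof -
    obtain q where q: "eval C t [str_code w] (of_bool (w \<in> B)) q"
      using t(2) unfolding turing_reduces_via_def by blast
    then have "w \<in> D C \<longleftrightarrow> 0 < (of_bool (w \<in> B) :: nat)"
      using eval_evals_deterministic(1)[OF q] unfolding D_def by blast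
    then show ?thesis by simp
  qed
  then have "D C = B" by blast
  have 1: "one_query_transducer p'"
    unfolding one_query_transducer_def p'_def
  proof (intro allI)
    fix X w
    obtain y q where "eval (D X) p [str_code w] y q" "q \<le> 1"
      using p(1) unfolding one_query_transducer_def by blast
    with eval_subst_query(1)[OF s this(1)]
    show "\<exists>y q. eval X (subst_query s p) [str_code w] y q \<and> q \<le> 1" by (metis mult_1 order_trans)
  qed
  have "turing_reduces_via p' A C"
    unfolding turing_reduces_via_def p'_def
  proof
    fix w
    obtain q where "eval (D C) p [str_code w] (of_bool (w \<in> A)) q"
      using p(2) \<open>D C = B\<close> unfolding turing_reduces_via_def by blast
    from eval_subst_query(1)[OF s this]
    show "\<exists>q. eval C (subst_query s p) [str_code w] (of_bool (w \<in> A)) q" by blast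
  qed
  with 1 show ?thesis unfolding one_tt_reducible_def by blast
qed

lemma equiv_one_tt_equiv: "equiv UNIV one_tt_equiv"
  by (auto simp: equiv_def refl_on_def sym_def trans_def one_tt_equiv_def intro: one_tt_refl one_tt_trans)

lemma eval_query_free:
  "eval X p xs y q \<Longrightarrow> query_free p \<Longrightarrow> q = 0 \<and> eval Y p xs y 0"
  "evals X ps xs ys q \<Longrightarrow> \<forall>p\<in>set ps. query_free p \<Longrightarrow> q = 0 \<and> evals Y ps xs ys 0"
proof (induction rule: eval_evals.inducts)
  case (eval_Mu n p xs y q)
  have "eval Y (Mu p) xs n (\<Sum>m\<le>n. 0)"
    by (rule eval_evals.eval_Mu[where y=y]) (use eval_Mu in auto)
  moreover have "q m = 0" if "m \<le> n" for m using that eval_Mu by (cases "m = n") auto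
  ultimately show ?case by simp
next
  case (eval_Comp ps xs ys q p z r)
  then show ?case using eval_evals.eval_Comp[of Y ps xs ys 0 p z 0] by simp
next
  case (eval_PrimRec_0 p xs y q p')
  then show ?case using eval_evals.eval_PrimRec_0[of Y p xs y 0 p'] by simp
next
  case (eval_PrimRec_Suc p p' n xs y q z r)
  then show ?case using eval_evals.eval_PrimRec_Suc[of Y p p' n xs y 0 z 0] by simp
next
  case (evals_Cons p xs y q ps ys r)
  then show ?case using eval_evals.evals_Cons[of Y p xs y 0 ps ys 0] by simp
qed (simp_all add: eval_Zero eval_Succ eval_Proj evals_Nil)

lemma query_free_subst_query: "query_free t \<Longrightarrow> query_free (subst_query t p)"
  by (induction t p rule: subst_query.induct) auto

lemma recursive_set_if_reducible: assumes "one_tt_reducible A B" "recursive_set B" shows "recursive_set A"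
proof -
  obtain t where t: "query_free t" "\<And>w. eval {} t [str_code w] (of_bool (w \<in> B)) 0"
    using assms unfolding recursive_set_def by blast
  obtain p where p: "turing_reduces_via p A B" using assms unfolding one_tt_reducible_def by blast
  have "eval {} (subst_query t p) [str_code w] (of_bool (w \<in> A)) 0" for w
  proof -
    obtain q where "eval B p [str_code w] (of_bool (w \<in> A)) q"
      using p unfolding turing_reduces_via_def by blast
    from eval_subst_query(1)[OF _ this, of 0 "{}" t] t(2) show ?thesis by auto
  qed
  with query_free_subst_query[OF t(1)] show ?thesis unfolding recursive_set_def by blast
qed

lemma one_tt_reducible_if_recursive: assumes "recursive_set A" shows "one_tt_reducible A B"
proof -
  obtain t where t: "query_free t" "\<And>w. eval {} t [str_code w] (of_bool (w \<in> A)) 0"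
    using assms unfolding recursive_set_def by blast
  then have "eval X t [str_code w] (of_bool (w \<in> A)) 0" for X w using eval_query_free(1) by blast
  then show ?thesis
    unfolding one_tt_reducible_def one_query_transducer_def turing_reduces_via_def
    by (meson zero_le)
qed

lemma recursive_sets_degree: "{A. recursive_set A} \<in> one_tt_degrees"
proof -
  have "recursive_set {}" unfolding recursive_set_def
    by (rule exI[of _ Zero]) (auto intro: eval_Zero)
  then have "{A. recursive_set A} = one_tt_equiv `` {{}}"
    unfolding one_tt_equiv_def using recursive_set_if_reducible one_tt_reducible_if_recursive by blast
  then show ?thesis unfolding one_tt_degrees_def by (simp add: quotientI)
qed


section \<open>Compression and ranking\<close>

definition compression_function :: "(str \<rightharpoonup> str) \<Rightarrow> str set \<Rightarrow> bool" where
  "compression_function f A \<longleftrightarrow> A \<subseteq> dom f \<and> f ` A = Some ` UNIV \<and> inj_on f A"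

definition ith_string :: "str set \<Rightarrow> nat \<Rightarrow> str \<Rightarrow> bool" where
  "ith_string A i x \<longleftrightarrow> x \<in> A \<and> card {y \<in> A. y \<le> x} = i"

definition ranking_function :: "(str \<rightharpoonup> str) \<Rightarrow> str set \<Rightarrow> bool" where
  "ranking_function f A \<longleftrightarrow> A \<subseteq> dom f \<and>
    (\<forall>x\<in>A. \<forall>i. ith_string A i x \<longrightarrow> ith_string UNIV i (the (f x)))"

definition recursively_compressible :: "str set \<Rightarrow> bool" where
  "recursively_compressible A \<longleftrightarrow>
    (\<exists>f. total_recursive f \<and> compression_function (\<lambda>x. Some (f x)) A)"

definition recursively_rankable :: "str set \<Rightarrow> bool" where
  "recursively_rankable A \<longleftrightarrow>
    (\<exists>f. total_recursive f \<and> ranking_function (\<lambda>x. Some (f x)) A)"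

end

(*
  Identify strings with their positions in the order, counted from 0. Given a nonrecursive B in the degree, let A
  contain 3n if n is in B and 3n+2 otherwise, and always 3n+1. Then A and B are 1-tt equivalent,
  and 3n, 3n+2 |-> 2n, 3n+1 |-> 2n+1 compresses A, because exactly one of 3n and 3n+2 lies in A.
  But the (1-based) rank of 3n+1 in A is 2n+2 or 2n+1 according to whether n is in B, so a recursive ranking
  function would decide B.
*)
theory Submission
  imports Defs
begin

section \<open>Recursive functions of fixed arity\<close>

text \<open>One program has to work for all \<open>X\<close> at once, so it can be run both inside a
  transducer and with the empty set. Values at lists of other lengths are left open.\<close>

definition computable :: "nat \<Rightarrow> (nat list \<Rightarrow> nat) \<Rightarrow> bool" where
  "computable k F \<longleftrightarrow>
    (\<exists>p. query_free p \<and> (\<forall>X xs. length xs = k \<longrightarrow> eval X p xs (F xs) 0))"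

lemma computable_cong:
  assumes "computable k F" "\<And>xs. length xs = k \<Longrightarrow> F xs = G xs"
  shows "computable k G"
  using assms unfolding computable_def by metis

lemma computable_zero: "computable k (\<lambda>_. 0)"
  unfolding computable_def using eval_Zero by (intro exI[of _ Zero]) simp

lemma computable_nth: "i < k \<Longrightarrow> computable k (\<lambda>xs. xs ! i)"
  unfolding computable_def using eval_Proj by (intro exI[of _ "Proj i"]) simp

lemma computable_comp_list:
  assumes "computable (length Fs) G" "\<forall>F\<in>set Fs. computable k F"
  shows "computable k (\<lambda>xs. G (map (\<lambda>F. F xs) Fs))"
proof -
  have "\<exists>ps. (\<forall>p\<in>set ps. query_free p) \<and>
      (\<forall>X xs. length xs = k \<longrightarrow> evals X ps xs (map (\<lambda>F. F xs) Fs) 0)"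
    using assms(2)
  proof (induction Fs)
    case Nil
    show ?case using evals_Nil by (intro exI[of _ "[]"]) simp
  next
    case (Cons F Fs)
    then obtain ps where ps: "\<forall>p\<in>set ps. query_free p"
      "\<And>X xs. length xs = k \<Longrightarrow> evals X ps xs (map (\<lambda>F. F xs) Fs) 0" by auto
    obtain p where p: "query_free p" "\<And>X xs. length xs = k \<Longrightarrow> eval X p xs (F xs) 0"
      using Cons.prems unfolding computable_def by auto
    show ?case
      using ps(1) p(1) evals_Cons[OF p(2) ps(2)] by (intro exI[of _ "p # ps"]) simp
  qed
  then obtain ps where ps: "\<forall>p\<in>set ps. query_free p"
    "\<And>X xs. length xs = k \<Longrightarrow> evals X ps xs (map (\<lambda>F. F xs) Fs) 0" by auto
  obtain p where p: "query_free p" "\<And>X xs. length xs = length Fs \<Longrightarrow> eval X p xs (G xs) 0"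
    using assms(1) unfolding computable_def by auto
  show ?thesis
    unfolding computable_def
    using ps(1) p(1) eval_Comp[OF ps(2) p(2)] by (intro exI[of _ "Comp p ps"]) simp
qed

lemma computable_comp:
  assumes "computable 1 (\<lambda>xs. g (xs ! 0))" "computable k F"
  shows "computable k (\<lambda>xs. g (F xs))"
  using computable_comp_list[of "[F]" "\<lambda>xs. g (xs ! 0)"] assms by simp

lemma computable_Suc:
  assumes "computable k F"
  shows "computable k (\<lambda>xs. Suc (F xs))"
proof -
  have "computable 1 (\<lambda>xs. Suc (xs ! 0))"
    unfolding computable_def
    using eval_Succ by (intro exI[of _ Succ]) (auto simp: length_Suc_conv)
  then show ?thesis using assms by (rule computable_comp)
qed

text \<open>Recursion steps receive the counter and the previous value in front of the parameters.
  Composing with the projections 1 to \<open>k\<close> lets a step ignore such a leading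
  argument.\<close>

lemma computable_tl:
  assumes "computable k F"
  shows "computable (Suc k) (\<lambda>xs. F (tl xs))"
proof -
  define Fs where "Fs = map (\<lambda>i xs. xs ! i :: nat) [1..<Suc k]"
  have "computable (Suc k) (\<lambda>xs. F (map (\<lambda>F. F xs) Fs))"
    by (rule computable_comp_list) (use assms computable_nth in \<open>auto simp: Fs_def simp del: upt_Suc\<close>)
  moreover have "map (\<lambda>F. F xs) Fs = tl xs" if "length xs = Suc k" for xs
    using that by (auto simp: Fs_def intro!: nth_equalityI simp: nth_tl simp del: upt_Suc)
  ultimately show ?thesis by (elim computable_cong) simp
qed

text \<open>\<open>PrimRec\<close> reads its depth from the first argument, so \<open>N xs\<close>
  is computed and placed before the parameters.\<close>

lemma computable_rec:
  assumes "computable k N" "computable k F" "computable (Suc (Suc k)) G"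
  shows "computable k (\<lambda>xs. rec_nat (F xs) (\<lambda>n y. G (n # y # xs)) (N xs))"
proof -
  define R where "R = (\<lambda>xs. rec_nat (F (tl xs)) (\<lambda>n y. G (n # y # tl xs)) (hd xs))"
  obtain p where p: "query_free p" "\<And>X xs. length xs = k \<Longrightarrow> eval X p xs (F xs) 0"
    using assms(2) unfolding computable_def by auto
  obtain p' where p': "query_free p'" "\<And>X xs. length xs = Suc (Suc k) \<Longrightarrow> eval X p' xs (G xs) 0"
    using assms(3) unfolding computable_def by auto
  have "eval X (PrimRec p p') (n # xs) (R (n # xs)) 0" if "length xs = k" for X n xs
  proof (induction n)
    case 0
    then show ?case using p(2)[OF that] by (auto simp: R_def intro: eval_PrimRec_0)
  next
    case (Suc n)
    then show ?case
      using eval_PrimRec_Suc[OF Suc p'(2)] that by (auto simp: R_def)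
  qed
  then have "computable (Suc k) R"
    unfolding computable_def using p(1) p'(1)
    by (intro exI[of _ "PrimRec p p'"]) (auto simp: length_Suc_conv)
  moreover define Fs where "Fs = N # map (\<lambda>i xs. xs ! i) [0..<k]"
  ultimately have "computable k (\<lambda>xs. R (map (\<lambda>F. F xs) Fs))"
    by (intro computable_comp_list) (use assms(1) computable_nth in auto)
  moreover have "map (\<lambda>F. F xs) Fs = N xs # xs" if "length xs = k" for xs
    using that by (auto simp: Fs_def intro!: nth_equalityI)
  ultimately show ?thesis by (elim computable_cong) (simp add: R_def)
qed

text \<open>A case distinction is a recursion of depth \<open>N xs\<close> whose step discards both
  counter and previous value: any positive depth yields \<open>G xs\<close>.\<close>

lemma computable_if_zero:
  assumes "computable k N" "computable k F" "computable k G"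
  shows "computable k (\<lambda>xs. if N xs = 0 then F xs else G xs)"
proof -
  have "computable (Suc (Suc k)) (\<lambda>xs. G (tl (tl xs)))"
    using computable_tl[OF computable_tl[OF assms(3)]] .
  from computable_rec[OF assms(1,2) this] show ?thesis
    by (rule computable_cong) (auto split: nat.split simp: gr0_conv_Suc)
qed

text \<open>The recursion step returns its counter, which is one below the depth; the base value 0
  gives the truncation.\<close>

lemma computable_pred:
  assumes "computable k F"
  shows "computable k (\<lambda>xs. F xs - 1)"
proof -
  have "rec_nat 0 (\<lambda>n y. n) m = m - 1" for m :: nat by (cases m) auto
  with computable_rec[OF assms computable_zero computable_nth[of 0]] show ?thesis by simp
qed

lemmas computable_intros =
  computable_zero computable_nth computable_Suc computable_if_zero computable_pred

lemma computable_unary_rec: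
  assumes "h 0 = 0" "\<And>n. h (Suc n) = G [n, h n]" "computable 2 G" "computable k F"
  shows "computable k (\<lambda>xs. h (F xs))"
proof -
  \<comment> \<open>At arity 1 the step has a third argument, the parameter itself, which is
    projected away.\<close>
  have G: "computable (Suc (Suc 1)) (\<lambda>xs. G [xs ! 0, xs ! 1])"
    using computable_comp_list[of "[\<lambda>xs. xs ! 0, \<lambda>xs. xs ! 1]" G 3] assms(3)
    by (simp add: computable_nth numeral_2_eq_2 numeral_3_eq_3)
  have "rec_nat 0 (\<lambda>n y. G [n, y]) m = h m" for m
    by (induction m) (simp_all add: assms(1,2))
  with computable_rec[OF computable_nth[of 0 1] computable_zero G]
  have "computable 1 (\<lambda>xs. h (xs ! 0))" by simp
  then show ?thesis using assms(4) by (rule computable_comp)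
qed

section \<open>Arithmetic with the constants 2 and 3\<close>

lemma computable_mod_2: "computable k F \<Longrightarrow> computable k (\<lambda>xs. F xs mod 2)"
  by (rule computable_unary_rec[where h = "\<lambda>n. n mod 2"
        and G = "\<lambda>xs. if xs ! 1 = 0 then Suc 0 else 0"])
    (auto intro!: computable_intros simp: mod_Suc)

lemma computable_mod_3: "computable k F \<Longrightarrow> computable k (\<lambda>xs. F xs mod 3)"
  by (rule computable_unary_rec[where h = "\<lambda>n. n mod 3" and
        G = "\<lambda>xs. if xs ! 1 = 0 then Suc 0 else if xs ! 1 - 1 = 0 then Suc (Suc 0) else 0"])
    (auto intro!: computable_intros simp: mod_Suc)

text \<open>The quotient grows from \<open>n\<close> to \<open>Suc n\<close> exactly when
  \<open>n mod 3 = 2\<close>; by truncation, \<open>n mod 3 - 1 = 0\<close> covers the two other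
  remainders.\<close>

lemma computable_div_3:
  assumes "computable k F"
  shows "computable k (\<lambda>xs. F xs div 3)"
proof (rule computable_unary_rec[where h = "\<lambda>n. n div 3" and
      G = "\<lambda>xs. if xs ! 0 mod 3 - 1 = 0 then xs ! 1 else Suc (xs ! 1)"])
  show "computable 2 (\<lambda>xs. if xs ! 0 mod 3 - 1 = 0 then xs ! 1 else Suc (xs ! 1))"
    by (intro computable_intros computable_mod_3) simp_all
qed (use assms in \<open>auto simp: div_Suc mod_Suc\<close>)

lemma computable_times_2: "computable k F \<Longrightarrow> computable k (\<lambda>xs. 2 * F xs)"
  by (rule computable_unary_rec[where h = "\<lambda>n. 2 * n" and G = "\<lambda>xs. Suc (Suc (xs ! 1))"])
    (auto intro!: computable_intros)

lemma computable_times_3: "computable k F \<Longrightarrow> computable k (\<lambda>xs. 3 * F xs)"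
  by (rule computable_unary_rec[where h = "\<lambda>n. 3 * n" and G = "\<lambda>xs. Suc (Suc (Suc (xs ! 1)))"])
    (auto intro!: computable_intros)


section \<open>Functions and sets of strings\<close>

definition nth_str :: "nat \<Rightarrow> str" where
  "nth_str = inv str_code"

lemma nth_str_code [simp]: "nth_str (str_code w) = w"
  unfolding nth_str_def using bij_is_inj[OF str_code_bij] by simp

lemma str_code_nth [simp]: "str_code (nth_str n) = n"
  unfolding nth_str_def using bij_is_surj[OF str_code_bij] by (rule surj_f_inv_f)

lemma total_recursive_iff_computable:
  "total_recursive f \<longleftrightarrow> computable 1 (\<lambda>xs. str_code (f (nth_str (xs ! 0))))"
proof
  assume "total_recursive f"
  then obtain p where p: "query_free p" "\<And>w. eval {} p [str_code w] (str_code (f w)) 0"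
    unfolding total_recursive_def by blast
  \<comment> \<open>A query-free run has the same result under every queried set, so a run with
    \<open>{}\<close> suffices.\<close>
  have "eval X p [n] (str_code (f (nth_str n))) 0" for X n
    using eval_query_free(1)[OF p(2) p(1)] by (metis str_code_nth)
  with p(1) show "computable 1 (\<lambda>xs. str_code (f (nth_str (xs ! 0))))"
    unfolding computable_def by (intro exI[of _ p]) (auto simp: length_Suc_conv)
next
  assume "computable 1 (\<lambda>xs. str_code (f (nth_str (xs ! 0))))"
  then show "total_recursive f"
    unfolding computable_def total_recursive_def
    by (metis One_nat_def length_Cons list.size(3) nth_Cons_0 nth_str_code)
qed

lemma recursive_set_if_computable:
  assumes "computable 1 (\<lambda>xs. of_bool (nth_str (xs ! 0) \<in> A))"
  shows "recursive_set A"
  using assms unfolding computable_def recursive_set_def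
  by (metis One_nat_def length_Cons list.size(3) nth_Cons_0 nth_str_code)

text \<open>The transducer computes the query with \<open>q\<close>, asks it, and evaluates
  \<open>g\<close> on input and answer. Since \<open>p\<close> and \<open>p'\<close> are query-free,
  it makes one query whatever the answers are.\<close>

lemma one_tt_reducibleI:
  assumes q: "computable 1 q" and g: "computable 2 g"
    and red: "\<And>w. of_bool (w \<in> A) = g [str_code w, of_bool (nth_str (q [str_code w]) \<in> B)]"
  shows "one_tt_reducible A B"
proof -
  obtain p where p: "\<And>X xs. length xs = 1 \<Longrightarrow> eval X p xs (q xs) 0"
    using q unfolding computable_def by blast
  obtain p' where p': "\<And>X xs. length xs = 2 \<Longrightarrow> eval X p' xs (g xs) 0"
    using g unfolding computable_def by blast
  define t where "t = Comp p' [Proj 0, Comp Query [p]]"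
  have t: "eval X t [n] (g [n, of_bool (nth_str (q [n]) \<in> X)]) 1" for X n
  proof -
    have "eval X (Comp Query [p]) [n] (of_bool (nth_str (q [n]) \<in> X)) 1"
      using eval_Comp[OF evals_singleton[OF p[of "[n]"]], where p = Query]
        eval_Query[of X "nth_str (q [n])"] by simp
    from evals_Cons[OF eval_Proj[of 0 "[n]"] evals_singleton[OF this]]
    have "evals X [Proj 0, Comp Query [p]] [n] [n, of_bool (nth_str (q [n]) \<in> X)] 1" by simp
    from eval_Comp[OF this p'] show ?thesis by (simp add: t_def)
  qed
  have "one_query_transducer t" unfolding one_query_transducer_def using t by blast
  moreover have "turing_reduces_via t A B"
    unfolding turing_reduces_via_def red using t by blast
  ultimately show ?thesis unfolding one_tt_reducible_def by blast
qed


section \<open>The witness\<close>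

text \<open>The equivalence handles remainders 0 and 2 together: at remainder 2 its right side is
  false, so membership in \<open>B\<close> is negated.\<close>

definition spread :: "str set \<Rightarrow> str set" where
  "spread B = {w. str_code w mod 3 = 1 \<or>
    (nth_str (str_code w div 3) \<in> B \<longleftrightarrow> str_code w mod 3 = 0)}"

lemma Suc_times_3_div_mod:
  fixes n :: nat
  shows "Suc (3 * n) div 3 = n" "Suc (3 * n) mod 3 = 1"
    "Suc (Suc (3 * n)) div 3 = n" "Suc (Suc (3 * n)) mod 3 = 2"
  by presburger+

lemma nth_str_in_spread [simp]:
  "nth_str (3 * n) \<in> spread B \<longleftrightarrow> nth_str n \<in> B"
  "nth_str (Suc (3 * n)) \<in> spread B"
  "nth_str (Suc (Suc (3 * n))) \<in> spread B \<longleftrightarrow> nth_str n \<notin> B"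
  by (simp_all add: spread_def Suc_times_3_div_mod)

text \<open>One query at the quotient suffices: the remainder decides between the answer, the
  constant 1 and the negated answer.\<close>

lemma spread_reducible: "one_tt_reducible (spread B) B"
proof (rule one_tt_reducibleI)
  show "computable 1 (\<lambda>xs. xs ! 0 div 3)"
    by (intro computable_div_3 computable_nth) simp
  show "computable 2 (\<lambda>xs. if xs ! 0 mod 3 = 0 then xs ! 1 else
      if xs ! 0 mod 3 - 1 = 0 then Suc 0 else if xs ! 1 = 0 then Suc 0 else 0)"
    by (intro computable_intros computable_mod_3) simp_all
qed (auto simp: spread_def)

lemma reducible_spread: "one_tt_reducible B (spread B)"
proof (rule one_tt_reducibleI)
  show "computable 1 (\<lambda>xs. 3 * xs ! 0)"
    by (intro computable_times_3 computable_nth) simp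
  show "computable 2 (\<lambda>xs. xs ! 1)"
    by (intro computable_nth) simp
qed simp

lemma recursively_compressible_spread: "recursively_compressible (spread B)"
proof -
  \<comment> \<open>Being a test for zero, \<open>m mod 3 - 1 = 0\<close> is computable as it stands; by truncation it also
    covers \<open>m mod 3 = 0\<close>.\<close>
  define h where
    "h m = (if m mod 3 - 1 = 0 then if m mod 3 = 0 then 2 * (m div 3) else Suc (2 * (m div 3))
      else 2 * (m div 3))" for m :: nat
  define f where "f w = nth_str (h (str_code w))" for w
  \<comment> \<open>Half of \<open>h m\<close> recovers the quotient and its parity tells whether
    the remainder is 1; only the difference between remainders 0 and 2 is lost.\<close>
  have h_div: "h m div 2 = m div 3" for m by (simp add: h_def)
  have h_odd: "odd (h m) \<longleftrightarrow> m mod 3 = 1" for m by (auto simp: h_def)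
  have "computable 1 (\<lambda>xs. h (xs ! 0))"
    unfolding h_def
    by (intro computable_intros computable_mod_3 computable_times_2 computable_div_3) simp_all
  then have "total_recursive f"
    by (simp add: total_recursive_iff_computable f_def)
  moreover have "inj_on f (spread B)"
  proof (rule inj_onI)
    fix v w assume vw: "v \<in> spread B" "w \<in> spread B" "f v = f w"
    have "h (str_code v) = h (str_code w)" using vw(3) unfolding f_def by (metis str_code_nth)
    with h_div h_odd have d: "str_code v div 3 = str_code w div 3"
      and m: "str_code v mod 3 = 1 \<longleftrightarrow> str_code w mod 3 = 1" by metis+
    have "str_code v mod 3 < 3" "str_code w mod 3 < 3" by simp_all
    \<comment> \<open>Remainders 0 and 2 over the same quotient would put that quotient both inside
      and outside \<open>B\<close>.\<close>
    with vw(1,2) d m have "str_code v mod 3 = str_code w mod 3"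
      by (auto simp: spread_def)
    with d have "str_code v = str_code w" by (metis div_mod_decomp)
    then show "v = w" by (metis nth_str_code)
  qed
  moreover have "u \<in> f ` spread B" for u
  proof -
    define n where "n = str_code u div 2"
    have h: "h (3 * n) = 2 * n" "h (Suc (3 * n)) = Suc (2 * n)" "h (Suc (Suc (3 * n))) = 2 * n"
      by (simp_all add: h_def Suc_times_3_div_mod)
    obtain m where "nth_str m \<in> spread B" "h m = str_code u"
    proof (cases "even (str_code u)")
      case True
      then have "h (3 * n) = str_code u" "h (Suc (Suc (3 * n))) = str_code u"
        using h by (simp_all add: n_def)
      \<comment> \<open>Which of the two preimages of \<open>2 * n\<close> lies in the set depends
        on \<open>B\<close>, but one of them does.\<close>
      then show ?thesis using that by (metis nth_str_in_spread(1,3))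
    next
      case False
      then show ?thesis using that[of "Suc (3 * n)"] h by (simp add: n_def)
    qed
    then show ?thesis by (intro image_eqI[of _ _ "nth_str m"]) (simp_all add: f_def)
  qed
  then have "(\<lambda>x. Some (f x)) ` spread B = Some ` UNIV" by (auto simp: image_iff)
  ultimately show ?thesis
    unfolding recursively_compressible_def compression_function_def
    by (intro exI[of _ f]) (auto simp: inj_on_def)
qed

section \<open>Ranks and the decision procedure for \<open>B\<close>\<close>

lemma card_below:
  "card {y \<in> A. y \<le> nth_str n} = (\<Sum>m<Suc n. of_bool (nth_str m \<in> A))"
proof -
  have "(\<Sum>m<Suc n. of_bool (nth_str m \<in> A)) = card {m. m \<le> n \<and> nth_str m \<in> A}"
    by (simp add: sum_of_bool_eq lessThan_Suc_atMost Int_def)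
  also have "\<dots> = card (str_code ` {y \<in> A. y \<le> nth_str n})"
  \<comment> \<open>\<open>str_code\<close> is an order isomorphism onto the naturals, so strings up
    to \<open>nth_str n\<close> correspond to positions up to \<open>n\<close>.\<close>
  proof (rule arg_cong[where f = card])
    show "{m. m \<le> n \<and> nth_str m \<in> A} = str_code ` {y \<in> A. y \<le> nth_str n}"
      using strict_mono_less_eq[OF str_code_strict_mono]
      by (auto simp: image_iff) (metis nth_str_code str_code_nth)+
  qed
  also have "\<dots> = card {y \<in> A. y \<le> nth_str n}"
    by (meson card_image inj_on_subset str_code_bij bij_is_inj subset_UNIV)
  finally show ?thesis by simp
qed

text \<open>Ranks start at 1 and codes at 0, hence the successor.\<close>

lemma ith_string_UNIV: "ith_string UNIV i v \<longleftrightarrow> i = Suc (str_code v)"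
  using card_below[of UNIV "str_code v"] by (auto simp: ith_string_def)

lemma rank_in_spread:
  "ith_string (spread B) (Suc (2 * n + of_bool (nth_str n \<in> B))) (nth_str (Suc (3 * n)))"
proof -
  \<comment> \<open>Each block of three positions contributes two elements. What remains is
    \<open>3 * n\<close>, present iff \<open>n\<close> is in \<open>B\<close>, and
    \<open>Suc (3 * n)\<close> itself.\<close>
  have "(\<Sum>m<3 * n. of_bool (nth_str m \<in> spread B)) = 2 * n"
  proof (induction n)
    case (Suc n)
    have "3 * Suc n = Suc (Suc (Suc (3 * n)))" by simp
    with Suc show ?case by (simp del: sum_of_bool_eq mult_Suc_right)
  qed simp
  then show ?thesis by (simp add: ith_string_def card_below)
qed

lemma recursive_if_spread_rankable:
  assumes "recursively_rankable (spread B)"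
  shows "recursive_set B"
proof -
  obtain f where f: "total_recursive f" "ranking_function (\<lambda>x. Some (f x)) (spread B)"
    using assms unfolding recursively_rankable_def by blast
  \<comment> \<open>The code of the ranking value is the rank minus 1, so its parity is the
    membership bit.\<close>
  have "str_code (f (nth_str (Suc (3 * n)))) = 2 * n + of_bool (nth_str n \<in> B)" for n
    using f(2) rank_in_spread[of B n] nth_str_in_spread(2)[of n B]
    unfolding ranking_function_def ith_string_UNIV by fastforce
  then have "str_code (f (nth_str (Suc (3 * n)))) mod 2 = of_bool (nth_str n \<in> B)" for n
    by simp
  moreover have "computable 1 (\<lambda>xs. str_code (f (nth_str (Suc (3 * xs ! 0)))) mod 2)"
  proof (rule computable_mod_2)
    have "computable 1 (\<lambda>xs. Suc (3 * xs ! 0))"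
      by (intro computable_Suc computable_times_3 computable_nth) simp
    with f(1)[unfolded total_recursive_iff_computable]
    show "computable 1 (\<lambda>xs. str_code (f (nth_str (Suc (3 * xs ! 0)))))"
      by (rule computable_comp)
  qed
  ultimately show ?thesis by (intro recursive_set_if_computable) simp
qed

theorem theorem8:
  assumes "D \<in> one_tt_degrees"
    and "D \<noteq> {A. recursive_set A}"
  shows "\<exists>A\<in>D. recursively_compressible A \<and> \<not> recursively_rankable A"
proof -
  obtain B where B: "D = one_tt_equiv `` {B}"
    using assms(1) unfolding one_tt_degrees_def by (auto elim: quotientE)
  \<comment> \<open>If \<open>B\<close> were recursive, its class would consist of exactly the
    recursive sets, which is the excluded degree.\<close>
  have "\<not> recursive_set B"
    using assms(2) recursive_set_if_reducible one_tt_reducible_if_recursive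
    unfolding B one_tt_equiv_def by blast
  moreover have "spread B \<in> D"
    unfolding B one_tt_equiv_def using spread_reducible reducible_spread by blast
  ultimately show ?thesis
    using recursively_compressible_spread recursive_if_spread_rankable by blast
qed

end
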